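(* Let $(z_k)_{k\in\mathbb{N}}$ be a sequence of pairwise distinct complex numbers with $|z_k|\to\infty$, let $f$ be a Weierstrass map whose simple zeros are the points $z_1,z_2,\ldots$, let $n\ge2$, and let $S(f)=\{(z,w)\in\mathbb{C}^2: w^n=f(z)\}$ with its tame translation structure. Let $\mathbb{C}^{\star}=\mathbb{C}\setminus\{z_k:k\in\mathbb{N}\}$. Let $v$ be a vector of $\mathbb{C}$. Then $v$ is a holonomy vector of $S(f)$ if and only if there is a saddle connection $L$ of $\mathbb{C}^{\star}$ with endpoints $z_r$ and $z_l$ such that either $v=z_r-z_l$ or $v=z_l-z_r$. Moreover, the set ${\rm Hol}(S(f))$ of holonomy vectors of $S(f)$ is countable.
   Context: Weierstrass map: for a sequence $(z_k)_{k\in\mathbb{N}}$ of distinct complex numbers with $|z_k|\to\infty$, a function $f(z)=h(z)z^{m}\prod_{k\ge 1,\,z_k\ne 0}\left(1-\frac{z}{z_k}\right)E_k(z)$, where $h$ is a zero-free entire function, $m=1$ if some $z_k=0$ and $m=0$ otherwise, and $E_k(z)=\exp\left[\sum_{s=1}^{d(k)}\frac1s\left(\frac{z}{z_k}\right)^s\right]$ with suitably large non-negative integers $d(k)$ (so that the product converges). Its zeros are simple and are exactly the points $z_k$. Translation structure on $S(f)$: let $p_{\mathbf z}:S(f)\to\mathbb{C}$, $(z,w)\mapsto z$. The restriction $p_{\mathbf z}: S(f)\setminus\{(z_k,0):k\in\mathbb{N}\}\to\mathbb{C}^{\star}$ is an unramified covering of degree $n$, by which the standard translation structure and flat metric of $\mathbb{C}^{\star}\subset\mathbb{C}$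 are pulled back. The metric completion is $S(f)$, and its cone points are exactly the points $(z_k,0)$. A saddle connection of a tame translation surface $S$ is a geodesic interval joining two cone points and having no cone points in its interior. A chart of the translation structure whose domain contains the saddle connection $\gamma$ without its endpoints sends it to a straight segment in $\mathbb{C}$; the two opposite vectors $\{v,-v\}\subset\mathbb{C}$ parallel to this segment and of norm equal to the length of $\gamma$ are the holonomy vectors of $\gamma$. ${\rm Hol}(S)$ is the set of all holonomy vectors of all saddle connections of $S$. A saddle connection of $\mathbb{C}^{\star}$ is a straight line segment $L$ in $\mathbb{C}$ whose endpoints are two different points $z_r,z_l$ of the sequence $(z_k)_{k\in\mathbb{N}}$ and such that $L$ without its endpoints is contained in $\mathbb{C}^{\star}$. *)

theory Defs
  imports "HOL-Complex_Analysis.Complex_Analysis"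
begin

section \<open>Weierstrass maps\<close>

text \<open>
  The library function \<^term>\<open>weierstrass_factor d u\<close> is
  $(1 - u) \exp(\sum_{s=1}^{d} u^s/s)$. Indices with $z_k = 0$ are left out of the product.
\<close>

definition weierstrass_term :: "(nat \<Rightarrow> complex) \<Rightarrow> (nat \<Rightarrow> nat) \<Rightarrow> nat \<Rightarrow> complex \<Rightarrow> complex" where
  "weierstrass_term z d k x = (if z k = 0 then 1 else weierstrass_factor (d k) (x / z k))"

text \<open>
  Convergence is the usual one for products of entire functions: at each point in the sense of
  infinite products (after removing finitely many factors the limit is nonzero), and the partial
  products converge uniformly on bounded sets. The classical choice of exponents, with
  $\sum_k (r/|z_k|)^{d(k)+1} < \infty$ for all $r > 0$, has this property.
\<close>

definition weierstrass_exponents :: "(nat \<Rightarrow> complex) \<Rightarrow> (nat \<Rightarrow> nat) \<Rightarrow> bool" where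
  "weierstrass_exponents z d \<longleftrightarrow>
     (\<forall>x. convergent_prod (\<lambda>k. weierstrass_term z d k x)) \<and>
     (\<forall>r. uniformly_convergent_on (cball 0 r) (\<lambda>N x. \<Prod>k<N. weierstrass_term z d k x))"

definition weierstrass_map :: "(nat \<Rightarrow> complex) \<Rightarrow> (complex \<Rightarrow> complex) \<Rightarrow> bool" where
  "weierstrass_map z f \<longleftrightarrow>
     (\<exists>h d. h holomorphic_on UNIV \<and> (\<forall>x. h x \<noteq> 0) \<and> weierstrass_exponents z d \<and>
        (\<forall>x. f x = h x * x ^ (if \<exists>k. z k = 0 then 1 else 0) *
                    prodinf (\<lambda>k. weierstrass_term z d k x)))"


section \<open>The surface and its translation structure\<close>

text \<open>
  All topological notions on the surface refer to the subspace topology of $\mathbb{C}^2$.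
\<close>

definition surface :: "(complex \<Rightarrow> complex) \<Rightarrow> nat \<Rightarrow> (complex \<times> complex) set" where
  "surface f n = {(x, w). w ^ n = f x}"

definition cone_points :: "(nat \<Rightarrow> complex) \<Rightarrow> (complex \<times> complex) set" where
  "cone_points z = range (\<lambda>k. (z k, 0))"

definition flat_part :: "(nat \<Rightarrow> complex) \<Rightarrow> (complex \<Rightarrow> complex) \<Rightarrow> nat \<Rightarrow> (complex \<times> complex) set" where
  "flat_part z f n = surface f n - cone_points z"

text \<open>
  The maximal translation atlas on \<^term>\<open>flat_part z f n\<close> pulled back along the covering
  \<^term>\<open>fst\<close>: its charts agree with \<^term>\<open>fst\<close> up to a locally constant translation.
\<close>

definition translation_chart ::
    "(nat \<Rightarrow> complex) \<Rightarrow> (complex \<Rightarrow> complex) \<Rightarrow> nat \<Rightarrow>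
     (complex \<times> complex) set \<Rightarrow> (complex \<times> complex \<Rightarrow> complex) \<Rightarrow> bool" where
  "translation_chart z f n U \<phi> \<longleftrightarrow>
     openin (top_of_set (flat_part z f n)) U \<and> open (\<phi> ` U) \<and>
     (\<exists>\<psi>. homeomorphism U (\<phi> ` U) \<phi> \<psi>) \<and>
     (\<forall>p\<in>U. \<exists>V c. openin (top_of_set U) V \<and> p \<in> V \<and> (\<forall>q\<in>V. \<phi> q = fst q + c))"

definition curve_length :: "real \<Rightarrow> real \<Rightarrow> (real \<Rightarrow> complex) \<Rightarrow> ennreal" where
  "curve_length a b c =
     (SUP ts \<in> {ts. sorted ts \<and> set ts \<subseteq> {a..b}}.
        \<Sum>i<length ts - 1. ennreal (dist (c (ts ! i)) (c (ts ! Suc i))))"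

text \<open>
  The flat metric on \<^term>\<open>flat_part z f n\<close> is the length metric for which curves have
  the Euclidean length of their projection.
\<close>

definition flat_dist ::
    "(nat \<Rightarrow> complex) \<Rightarrow> (complex \<Rightarrow> complex) \<Rightarrow> nat \<Rightarrow>
     complex \<times> complex \<Rightarrow> complex \<times> complex \<Rightarrow> ennreal" where
  "flat_dist z f n p q =
     (INF g \<in> {g. path g \<and> path_image g \<subseteq> flat_part z f n \<and> pathstart g = p \<and> pathfinish g = q}.
        curve_length 0 1 (fst \<circ> g))"


section \<open>Saddle connections and holonomy vectors\<close>

text \<open>
  A saddle connection is parametrised by arc length on $[0,l]$. Being a geodesic means being
  locally distance realising; at the two ends, where the curve leaves the part carrying
  \<^term>\<open>flat_dist\<close> and enters the completion, this is automatic from continuity.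
  The two cone points are not required to be different.
\<close>

definition saddle_connection ::
    "(nat \<Rightarrow> complex) \<Rightarrow> (complex \<Rightarrow> complex) \<Rightarrow> nat \<Rightarrow>
     real \<Rightarrow> (real \<Rightarrow> complex \<times> complex) \<Rightarrow> bool" where
  "saddle_connection z f n l \<gamma> \<longleftrightarrow>
     l > 0 \<and> continuous_on {0..l} \<gamma> \<and> \<gamma> ` {0..l} \<subseteq> surface f n \<and>
     \<gamma> 0 \<in> cone_points z \<and> \<gamma> l \<in> cone_points z \<and>
     \<gamma> ` {0<..<l} \<inter> cone_points z = {} \<and>
     (\<forall>t\<in>{0<..<l}. \<exists>e>0. \<forall>s\<in>{0<..<l}. \<forall>s'\<in>{0<..<l}.
        \<bar>s - t\<bar> < e \<longrightarrow> \<bar>s' - t\<bar> < e \<longrightarrow>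
        flat_dist z f n (\<gamma> s) (\<gamma> s') = ennreal \<bar>s - s'\<bar>)"

definition holonomy_vector_of ::
    "(nat \<Rightarrow> complex) \<Rightarrow> (complex \<Rightarrow> complex) \<Rightarrow> nat \<Rightarrow>
     real \<Rightarrow> (real \<Rightarrow> complex \<times> complex) \<Rightarrow> complex \<Rightarrow> bool" where
  "holonomy_vector_of z f n l \<gamma> v \<longleftrightarrow>
     (\<exists>U \<phi> a b. translation_chart z f n U \<phi> \<and> \<gamma> ` {0<..<l} \<subseteq> U \<and>
        \<phi> ` \<gamma> ` {0<..<l} = open_segment a b \<and>
        (\<exists>c::real. v = c *\<^sub>R (b - a)) \<and>
        ennreal (norm v) = curve_length 0 l (fst \<circ> \<gamma>))"

definition Hol :: "(nat \<Rightarrow> complex) \<Rightarrow> (complex \<Rightarrow> complex) \<Rightarrow> nat \<Rightarrow> complex set" where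
  "Hol z f n = {v. \<exists>l \<gamma>. saddle_connection z f n l \<gamma> \<and> holonomy_vector_of z f n l \<gamma> v}"

definition punctured_plane :: "(nat \<Rightarrow> complex) \<Rightarrow> complex set" where
  "punctured_plane z = UNIV - range z"

definition plane_saddle_connection ::
    "(nat \<Rightarrow> complex) \<Rightarrow> nat \<Rightarrow> nat \<Rightarrow> complex set \<Rightarrow> bool" where
  "plane_saddle_connection z r l L \<longleftrightarrow>
     z r \<noteq> z l \<and> L = closed_segment (z r) (z l) \<and> L - {z r, z l} \<subseteq> punctured_plane z"

end

(* A Weierstrass map is continuous with zero set range z, so over every contractible open set
   avoiding the z k there is a continuous n-th root of f whose graph is open in the flat part. Over
   convex subsets such a graph is isometric to its projection. Hence the projection of a saddle
   connection is locally distance preserving, so locally affine, so affine with unit speed: a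
   segment between two zeros. A chart differs from the projection by a constant along the curve,
   which determines the holonomy up to sign. Conversely a segment between two zeros is lifted along
   a root of f, which extends by 0 at both ends. *)
theory Submission
  imports Defs
begin

section \<open>Affine curves\<close>

text \<open>The distances of \<open>c s\<close> to \<open>c a\<close> and to \<open>c b\<close>
  determine by polarisation that \<open>inner (c s - c a) u = s - a\<close>. Since
  \<open>c s - c a\<close> has norm \<open>\<bar>s - a\<bar>\<close>, this is the equality case of
  Cauchy-Schwarz, and the component orthogonal to \<open>u\<close> vanishes.\<close>

lemma isometric_imp_affine:
  fixes c :: "real \<Rightarrow> 'a::real_inner"
  assumes iso: "\<And>s s'. s \<in> S \<Longrightarrow> s' \<in> S \<Longrightarrow> dist (c s) (c s') = \<bar>s - s'\<bar>"
    and ab: "a \<in> S" "b \<in> S" "a \<noteq> b"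
  obtains u where "norm u = 1" "\<And>s. s \<in> S \<Longrightarrow> c s = c a + (s - a) *\<^sub>R u"
proof
  define v where "v = c b - c a"
  define u where "u = v /\<^sub>R (b - a)"
  have v: "norm v = \<bar>b - a\<bar>"
    using iso[OF ab(2,1)] by (simp add: v_def dist_norm)
  then show nu: "norm u = 1"
    using ab by (simp add: u_def)
  show "c s = c a + (s - a) *\<^sub>R u" if s: "s \<in> S" for s
  proof -
    define y where "y = c s - c a"
    have y: "norm y = \<bar>s - a\<bar>" and yv: "norm (y - v) = \<bar>s - b\<bar>"
      using iso[OF s ab(1)] iso[OF s ab(2)] by (simp_all add: y_def v_def dist_norm)
    have "(norm (y - v))\<^sup>2 = (norm y)\<^sup>2 - 2 * inner y v + (norm v)\<^sup>2"
      by (simp add: power2_norm_eq_inner inner_diff inner_commute)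
    then have "(s - b)\<^sup>2 = (s - a)\<^sup>2 - 2 * inner y v + (b - a)\<^sup>2"
      by (simp add: y yv v)
    then have "inner y v = (s - a) * (b - a)"
      by (simp add: power2_eq_square algebra_simps)
    then have yu: "inner y u = s - a"
      using ab by (simp add: u_def)
    have "(norm (y - (s - a) *\<^sub>R u))\<^sup>2 = (norm y)\<^sup>2 - 2 * ((s - a) * inner y u) + (norm ((s - a) *\<^sub>R u))\<^sup>2"
      by (simp only: power2_norm_eq_inner inner_diff inner_commute) (simp add: inner_commute)
    also have "\<dots> = 0"
      by (simp add: y yu nu power2_eq_square)
    finally show ?thesis
      by (simp add: y_def algebra_simps)
  qed
qed

text \<open>Local constancy on a connected set is used twice: first for the derivative, which gives
  one direction \<open>u\<close>, then for \<open>c s - s *\<^sub>R u\<close>, which gives the base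
  point.\<close>

lemma locally_affine_imp_affine:
  fixes c :: "real \<Rightarrow> 'a::real_normed_vector"
  assumes "open I" "connected I"
    and loc: "\<And>t. t \<in> I \<Longrightarrow> \<exists>e>0. \<exists>u. \<forall>s\<in>ball t e \<inter> I. c s = c t + (s - t) *\<^sub>R u"
  obtains a u where "\<And>s. s \<in> I \<Longrightarrow> c s = a + s *\<^sub>R u"
proof -
  \<comment> \<open>The derivative singles out the local direction, so that the directions chosen at
    different points can be compared.\<close>
  define D where "D s = vector_derivative c (at s)" for s
  have loc': "\<exists>e>0. \<forall>s\<in>ball t e \<inter> I. D s = D t \<and> c s = c t + (s - t) *\<^sub>R D t" if t: "t \<in> I" for t
  proof -
    obtain e u where e: "e > 0" and u: "\<And>s. s \<in> ball t e \<inter> I \<Longrightarrow> c s = c t + (s - t) *\<^sub>R u"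
      using loc[OF t] by blast
    have D: "D s = u" if s: "s \<in> ball t e \<inter> I" for s
    proof -
      have "((\<lambda>s. c t + (s - t) *\<^sub>R u) has_vector_derivative u) (at s)"
        by (auto intro!: derivative_eq_intros)
      then have "(c has_vector_derivative u) (at s)"
      proof (rule has_vector_derivative_transform_within_open)
        show "open (ball t e \<inter> I)"
          using \<open>open I\<close> by auto
      qed (use s in \<open>simp_all only: u\<close>)
      then show ?thesis
        by (simp add: D_def vector_derivative_at)
    qed
    show ?thesis
    proof (intro exI conjI ballI)
      fix s assume s: "s \<in> ball t e \<inter> I"
      have "D t = u"
        using e t by (intro D) simp
      then show "D s = D t" "c s = c t + (s - t) *\<^sub>R D t"
        using D[OF s] u[OF s] by simp_all
    qed (fact e)
  qed
  have "D constant_on I"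
  proof (rule locally_constant_imp_constant[OF \<open>connected I\<close>])
    fix t assume t: "t \<in> I"
    obtain e where e: "e > 0" "\<forall>s\<in>ball t e \<inter> I. D s = D t"
      using loc'[OF t] by blast
    show "\<exists>T. openin (top_of_set I) T \<and> t \<in> T \<and> (\<forall>x\<in>T. D x = D t)"
    proof (intro exI conjI ballI)
      show "D x = D t" if "x \<in> I \<inter> ball t e" for x
        using e(2) that by blast
    qed (use e(1) t in \<open>auto intro: openin_open_Int\<close>)
  qed
  then obtain u where u: "\<And>s. s \<in> I \<Longrightarrow> D s = u"
    by (auto simp: constant_on_def)
  have "(\<lambda>s. c s - s *\<^sub>R u) constant_on I"
  proof (rule locally_constant_imp_constant[OF \<open>connected I\<close>])
    fix t assume t: "t \<in> I"
    obtain e where e: "e > 0" "\<forall>s\<in>ball t e \<inter> I. c s = c t + (s - t) *\<^sub>R D t"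
      using loc'[OF t] by blast
    then have e': "c s - s *\<^sub>R u = c t - t *\<^sub>R u" if "s \<in> I \<inter> ball t e" for s
    proof -
      have "c s = c t + (s - t) *\<^sub>R u"
        using e(2) that u[OF t] by blast
      then show ?thesis
        by (simp add: scaleR_diff_left)
    qed
    show "\<exists>T. openin (top_of_set I) T \<and> t \<in> T \<and> (\<forall>x\<in>T. c x - x *\<^sub>R u = c t - t *\<^sub>R u)"
      by (intro exI[of _ "I \<inter> ball t e"] conjI ballI)
        (use e(1) t in \<open>auto intro: openin_open_Int e'\<close>)
  qed
  then obtain a where "\<And>s. s \<in> I \<Longrightarrow> c s - s *\<^sub>R u = a"
    by (auto simp: constant_on_def)
  then show ?thesis
    by (intro that[of a u]) (simp add: algebra_simps)
qed

section \<open>Length of plane curves\<close>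

lemma curve_length_ge_dist:
  assumes "a \<le> b"
  shows "ennreal (dist (c a) (c b)) \<le> curve_length a b c"
  unfolding curve_length_def by (rule SUP_upper2[of "[a, b]"]) (use assms in auto)

text \<open>The chord lengths of any partition telescope to at most \<open>(q - p) * norm u\<close>;
  the partition by the two ends attains this value.\<close>

lemma curve_length_affine:
  assumes "p \<le> q" and aff: "\<And>s. s \<in> {p..q} \<Longrightarrow> c s = a + s *\<^sub>R u"
  shows "curve_length p q c = ennreal ((q - p) * norm u)"
proof (rule antisym)
  have d: "dist (c s) (c s') = \<bar>s' - s\<bar> * norm u" if "s \<in> {p..q}" "s' \<in> {p..q}" for s s'
  proof -
    have "c s' - c s = (s' - s) *\<^sub>R u"
      using that by (simp add: aff scaleR_left_diff_distrib)
    then show ?thesis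
      by (metis dist_commute dist_norm norm_scaleR)
  qed
  show "ennreal ((q - p) * norm u) \<le> curve_length p q c"
    using curve_length_ge_dist[OF \<open>p \<le> q\<close>, of c] d[of p q] \<open>p \<le> q\<close> by simp
  show "curve_length p q c \<le> ennreal ((q - p) * norm u)"
    unfolding curve_length_def
  proof (rule SUP_least, clarify)
    fix ts :: "real list"
    assume ts: "sorted ts" "set ts \<subseteq> {p..q}"
    have "(\<Sum>i<length ts - 1. ennreal (dist (c (ts ! i)) (c (ts ! Suc i))))
        = ennreal (\<Sum>i<length ts - 1. dist (c (ts ! i)) (c (ts ! Suc i)))"
      by (rule sum_ennreal) simp
    also have "(\<Sum>i<length ts - 1. dist (c (ts ! i)) (c (ts ! Suc i)))
        = (\<Sum>i<length ts - 1. (ts ! Suc i - ts ! i) * norm u)"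
    proof (rule sum.cong[OF refl])
      fix i assume "i \<in> {..<length ts - 1}"
      then have i: "Suc i < length ts" by auto
      then have "ts ! i \<in> {p..q}" "ts ! Suc i \<in> {p..q}"
        using ts(2) by (meson Suc_lessD nth_mem subsetD)+
      moreover have "ts ! i \<le> ts ! Suc i"
        using ts(1) i by (simp add: sorted_nth_mono)
      ultimately show "dist (c (ts ! i)) (c (ts ! Suc i)) = (ts ! Suc i - ts ! i) * norm u"
        by (simp add: d)
    qed
    also have "\<dots> = (ts ! (length ts - 1) - ts ! 0) * norm u"
      by (simp flip: sum_distrib_right add: sum_lessThan_telescope)
    also have "\<dots> \<le> (q - p) * norm u"
    \<comment> \<open>For the empty list truncated subtraction makes both indices 0, so the
      difference vanishes whatever \<open>ts ! 0\<close> is.\<close>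
    proof (cases "ts = []")
      case False
      then have "ts ! (length ts - 1) \<in> {p..q}" "ts ! 0 \<in> {p..q}"
        using ts(2) by (meson diff_less length_greater_0_conv nth_mem subsetD zero_less_one)+
      then show ?thesis
        by (intro mult_right_mono) auto
    qed (use \<open>p \<le> q\<close> in simp)
    finally show "(\<Sum>i<length ts - 1. ennreal (dist (c (ts ! i)) (c (ts ! Suc i))))
        \<le> ennreal ((q - p) * norm u)"
      by (simp add: ennreal_leI)
  qed
qed

section \<open>Weierstrass maps\<close>

text \<open>A uniform limit of continuous partial products is continuous on each closed ball, and
  continuity is local.\<close>

lemma continuous_on_weierstrass_prod:
  assumes "weierstrass_exponents z d"
  shows "continuous_on UNIV (\<lambda>x. prodinf (\<lambda>k. weierstrass_term z d k x))"
proof -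
  let ?P = "\<lambda>N x. \<Prod>k<N. weierstrass_term z d k x"
  \<comment> \<open>Uniform convergence only yields the pointwise \<open>lim\<close> as limit
    function; pointwise convergence of the product identifies it with
    \<open>prodinf\<close>.\<close>
  have lim: "lim (\<lambda>N. ?P N x) = prodinf (\<lambda>k. weierstrass_term z d k x)" for x
    using assms convergent_prod_LIMSEQ[of "\<lambda>k. weierstrass_term z d k x"]
    unfolding weierstrass_exponents_def by (intro limI) (simp add: LIMSEQ_lessThan_iff_atMost)
  have cont_term: "continuous_on A (weierstrass_term z d k)" for A k
    unfolding weierstrass_term_def by (cases "z k = 0") (auto intro!: continuous_intros)
  have "continuous_on (cball 0 r) (\<lambda>x. prodinf (\<lambda>k. weierstrass_term z d k x))" for r
  proof (rule uniform_limit_theorem)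
    show "uniform_limit (cball 0 r) ?P (\<lambda>x. prodinf (\<lambda>k. weierstrass_term z d k x)) sequentially"
      using assms lim unfolding weierstrass_exponents_def uniformly_convergent_uniform_limit_iff
      by simp
  qed (auto intro!: always_eventually continuous_intros cont_term)
  then have "isCont (\<lambda>x. prodinf (\<lambda>k. weierstrass_term z d k x)) x" for x
    by (rule continuous_on_interior[of "cball 0 (norm x + 1)"]) simp
  then show ?thesis
    by (simp add: continuous_at_imp_continuous_on)
qed

text \<open>A product convergent in the strict sense vanishes only through one of its factors. A
  zero at the origin comes from the power of \<open>x\<close> in the Weierstrass map, hence the
  exclusion of \<open>x = 0\<close> here.\<close>

lemma weierstrass_prod_eq_0_iff:
  assumes "weierstrass_exponents z d"
  shows "prodinf (\<lambda>k. weierstrass_term z d k x) = 0 \<longleftrightarrow> x \<noteq> 0 \<and> x \<in> range z"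
proof -
  have "(\<lambda>k. weierstrass_term z d k x) has_prod prodinf (\<lambda>k. weierstrass_term z d k x)"
    using assms by (simp add: weierstrass_exponents_def convergent_prod_has_prod)
  then have "prodinf (\<lambda>k. weierstrass_term z d k x) = 0 \<longleftrightarrow> (\<exists>k. weierstrass_term z d k x = 0)"
    by (subst has_prod_eq_0_iff) (force simp: image_iff)+
  also have "\<dots> \<longleftrightarrow> x \<noteq> 0 \<and> x \<in> range z"
    by (auto simp: weierstrass_term_def)
  finally show ?thesis .
qed

lemma weierstrass_map_continuous:
  assumes "weierstrass_map z f"
  shows "continuous_on UNIV f"
proof -
  obtain h d where h: "h holomorphic_on UNIV" and d: "weierstrass_exponents z d"
    and f: "f = (\<lambda>x. h x * x ^ (if \<exists>k. z k = 0 then 1 else 0) *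
      prodinf (\<lambda>k. weierstrass_term z d k x))"
    using assms unfolding weierstrass_map_def by blast
  show ?thesis
    unfolding f
    by (intro continuous_on_mult continuous_on_power continuous_on_id
        continuous_on_weierstrass_prod[OF d] holomorphic_on_imp_continuous_on[OF h])
qed

lemma weierstrass_map_eq_0_iff:
  assumes "weierstrass_map z f"
  shows "f x = 0 \<longleftrightarrow> x \<in> range z"
proof -
  obtain h d where h: "h x \<noteq> 0" and d: "weierstrass_exponents z d"
    and f: "f x = h x * x ^ (if \<exists>k. z k = 0 then 1 else 0) *
      prodinf (\<lambda>k. weierstrass_term z d k x)"
    using assms unfolding weierstrass_map_def by blast
  show ?thesis
    using h by (auto simp: f weierstrass_prod_eq_0_iff[OF d])
qed

section \<open>The cyclic cover\<close>

text \<open>Isolates the facts about a Weierstrass map on which the geometry of the surface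
  rests.\<close>

locale cyclic_cover =
  fixes z :: "nat \<Rightarrow> complex" and f :: "complex \<Rightarrow> complex" and n :: nat
  assumes cont: "continuous_on UNIV f"
    and zeros: "f x = 0 \<longleftrightarrow> x \<in> range z"
    and n: "n > 0"
begin

lemma closed_zeros: "closed (range z)"
proof -
  have "closed (f -` {0})"
    using cont by (intro closed_vimage) auto
  moreover have "f -` {0} = range z"
    by (auto simp: zeros)
  ultimately show ?thesis by simp
qed

text \<open>Over a zero of \<open>f\<close> the equation \<open>w ^ n = 0\<close> has only the
  solution 0, so each such fibre is a single cone point.\<close>

lemma surface_in_cone_points: "p \<in> surface f n \<Longrightarrow> p \<in> cone_points z \<longleftrightarrow> fst p \<in> range z"
  using n zeros[of "fst p"] by (cases p) (auto simp: surface_def cone_points_def)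

lemma flat_part_eq: "flat_part z f n = {p \<in> surface f n. fst p \<notin> range z}"
  using surface_in_cone_points by (auto simp: flat_part_def)

section \<open>Continuous branches of the n-th root\<close>

text \<open>These are the local sections of the covering \<open>fst\<close> of the flat part; their
  graphs serve as sheets and as chart domains.\<close>

definition root_section :: "complex set \<Rightarrow> (complex \<Rightarrow> complex) \<Rightarrow> bool" where
  "root_section V g \<longleftrightarrow>
     open V \<and> V \<inter> range z = {} \<and> continuous_on V g \<and> (\<forall>x\<in>V. g x ^ n = f x)"

lemma root_section_graph:
  "root_section V g \<Longrightarrow> x \<in> V \<Longrightarrow> (x, g x) \<in> flat_part z f n"
  by (auto simp: root_section_def flat_part_eq surface_def)

text \<open>The statement follows from a continuous logarithm of \<open>f\<close> on the
  contractible set: dividing it by \<open>n\<close> and exponentiating gives one root, which a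
  constant factor then adjusts to the prescribed value at \<open>x\<close>.\<close>

lemma root_section_exists:
  assumes V: "open V" "contractible V" "V \<inter> range z = {}" "x \<in> V" and w: "w ^ n = f x"
  obtains g where "root_section V g" "g x = w"
proof -
  have nz: "f y \<noteq> 0" if "y \<in> V" for y
    using that V zeros by blast
  obtain L where L: "continuous_on V L" "\<And>y. y \<in> V \<Longrightarrow> f y = exp (L y)"
    using continuous_logarithm_on_contractible[of V f] continuous_on_subset[OF cont] V(2) nz
    by (metis subset_UNIV)
  define h where "h y = exp (L y / of_nat n)" for y
  have h: "h y ^ n = f y" if "y \<in> V" for y
    using n L(2)[OF that] by (simp add: h_def flip: exp_of_nat_mult)
  show ?thesis
  proof
    \<comment> \<open>The factor \<open>w / h x\<close> is an n-th root of unity, because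
      \<open>w\<close> and \<open>h x\<close> are both roots of \<open>f x\<close>.\<close>
    show "root_section V (\<lambda>y. w / h x * h y)"
      unfolding root_section_def
    proof (intro conjI ballI V)
      show "continuous_on V (\<lambda>y. w / h x * h y)"
        unfolding h_def by (intro continuous_intros L) (use n in auto)
      show "(w / h x * h y) ^ n = f y" if "y \<in> V" for y
        using h[OF that] h[OF \<open>x \<in> V\<close>] w nz[OF \<open>x \<in> V\<close>]
        by (simp add: power_mult_distrib power_divide)
    qed
  qed (simp add: h_def)
qed

text \<open>The sheets over \<open>V\<close> are separated because the roots of unity form a discrete set.\<close>

lemma openin_root_section_graph:
  assumes g: "root_section V g"
  shows "openin (top_of_set (flat_part z f n)) ((\<lambda>x. (x, g x)) ` V)"
proof -
  have V: "open V" "continuous_on V g" and root: "\<And>x. x \<in> V \<Longrightarrow> g x ^ n = f x"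
    using g unfolding root_section_def by blast+
  have nz: "g x \<noteq> 0" if "x \<in> V" for x
  proof
    assume "g x = 0"
    then have "f x = 0"
      using root[OF that] n by (metis power_eq_0_iff)
    then show False
      using g that zeros unfolding root_section_def by blast
  qed
  obtain \<delta> where \<delta>: "\<delta> > 0" "\<And>\<zeta>::complex. \<zeta> ^ n = 1 \<Longrightarrow> \<zeta> \<noteq> 1 \<Longrightarrow> \<delta> \<le> dist 1 \<zeta>"
    using finite_set_avoid[of "{\<zeta>::complex. \<zeta> ^ n = 1}" 1] finite_roots_unity[of n] n by auto
  \<comment> \<open>A point of the flat part over \<open>x\<close> is \<open>g x\<close> times an
    n-th root of unity; keeping the quotient within \<open>\<delta>\<close> of 1 leaves only the
    graph.\<close>
  define W where "W = (V \<times> UNIV) \<inter> (\<lambda>p. snd p / g (fst p)) -` ball 1 \<delta>"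
  have "continuous_on (V \<times> UNIV) (\<lambda>p. g (fst p))"
    by (rule continuous_on_compose2[OF V(2)]) (auto intro!: continuous_intros)
  then have "continuous_on (V \<times> UNIV) (\<lambda>p. snd p / g (fst p))"
    using nz by (intro continuous_intros) auto
  then have "open W"
    unfolding W_def by (rule continuous_open_preimage) (auto intro: open_Times V)
  moreover have "(\<lambda>x. (x, g x)) ` V = flat_part z f n \<inter> W"
  proof (intro equalityI subsetI)
    fix p assume "p \<in> (\<lambda>x. (x, g x)) ` V"
    then show "p \<in> flat_part z f n \<inter> W"
      using root_section_graph[OF g] nz \<delta>(1) by (auto simp: W_def)
  next
    fix p assume p: "p \<in> flat_part z f n \<inter> W"
    obtain x w where xw: "p = (x, w)" by (cases p)
    have x: "x \<in> V" and w: "w ^ n = f x" and d: "dist 1 (w / g x) < \<delta>"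
      using p by (auto simp: xw W_def flat_part_eq surface_def)
    have "(w / g x) ^ n = 1"
      using w root[OF x, symmetric] nz[OF x] by (simp add: power_divide)
    then have "w / g x = 1"
      using \<delta>(2)[of "w / g x"] d by linarith
    then show "p \<in> (\<lambda>x. (x, g x)) ` V"
      using x nz[OF x] by (auto simp: xw)
  qed
  ultimately show ?thesis
    by (auto simp: openin_open)
qed

section \<open>Comparison of the flat and the Euclidean distance\<close>

text \<open>Every competing curve has the length of its projection, which is at least the distance
  between its projected ends.\<close>

lemma flat_dist_ge: "ennreal (dist (fst p) (fst q)) \<le> flat_dist z f n p q"
  unfolding flat_dist_def
proof (rule INF_greatest, clarify)
  fix g :: "real \<Rightarrow> complex \<times> complex"
  show "ennreal (dist (fst (pathstart g)) (fst (pathfinish g))) \<le> curve_length 0 1 (fst \<circ> g)"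
    using curve_length_ge_dist[of 0 1 "fst \<circ> g"] by (simp add: pathstart_def pathfinish_def)
qed

text \<open>Lifting the straight segment by \<open>g\<close> gives a competing curve that attains
  the lower bound \<open>flat_dist_ge\<close>.\<close>

lemma flat_dist_root_section:
  assumes g: "root_section V g" and xy: "closed_segment x y \<subseteq> V"
  shows "flat_dist z f n (x, g x) (y, g y) = ennreal (dist x y)"
proof (rule antisym)
  let ?c = "\<lambda>t. (linepath x y t, g (linepath x y t))"
  have lp: "linepath x y t \<in> V" if "t \<in> {0..1}" for t
    using xy that linepath_in_path[of t x y] by auto
  have "continuous_on {0..1} (\<lambda>t. g (linepath x y t))"
    by (rule continuous_on_compose2[of V g, OF _ continuous_on_linepath])
      (use g lp in \<open>auto simp only: root_section_def\<close>)
  then have "path ?c"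
    unfolding path_def by (intro continuous_on_Pair continuous_on_linepath)
  moreover have "path_image ?c \<subseteq> flat_part z f n"
    using root_section_graph[OF g] lp by (auto simp: path_image_def)
  moreover have "pathstart ?c = (x, g x)" "pathfinish ?c = (y, g y)"
    by (simp_all add: pathstart_def pathfinish_def linepath_def)
  ultimately have "flat_dist z f n (x, g x) (y, g y) \<le> curve_length 0 1 (fst \<circ> ?c)"
    unfolding flat_dist_def by (intro INF_lower) auto
  also have "\<dots> = ennreal ((1 - 0) * norm (y - x))"
    by (rule curve_length_affine[where a = x]) (simp_all add: linepath_def scaleR_left_diff_distrib scaleR_diff_right)
  also have "\<dots> = ennreal (dist x y)"
    by (simp add: dist_norm norm_minus_commute)
  finally show "flat_dist z f n (x, g x) (y, g y) \<le> ennreal (dist x y)" .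
qed (use flat_dist_ge[of "(x, g x)" "(y, g y)"] in simp)

section \<open>Saddle connections project to straight segments\<close>

lemma saddle_connection_interior:
  assumes "saddle_connection z f n l \<gamma>"
  shows "continuous_on {0<..<l} \<gamma>" "\<gamma> ` {0<..<l} \<subseteq> flat_part z f n"
proof -
  have sub: "{0<..<l} \<subseteq> {0..l}" by auto
  show "continuous_on {0<..<l} \<gamma>"
    using assms continuous_on_subset[OF _ sub] by (auto simp: saddle_connection_def)
  show "\<gamma> ` {0<..<l} \<subseteq> flat_part z f n"
    using assms sub unfolding saddle_connection_def flat_part_def by blast
qed

text \<open>Near time \<open>t\<close> the curve stays in the graph of a root over a disc around its
  projected position. There the flat distance is Euclidean, since the disc is convex.\<close>

lemma saddle_connection_locally_isometric:
  assumes sc: "saddle_connection z f n l \<gamma>" and t: "t \<in> {0<..<l}"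
  obtains e where "e > 0"
    "\<And>s s'. s \<in> ball t e \<inter> {0<..<l} \<Longrightarrow> s' \<in> ball t e \<inter> {0<..<l} \<Longrightarrow>
       dist (fst (\<gamma> s)) (fst (\<gamma> s')) = \<bar>s - s'\<bar>"
proof -
  obtain e where e: "e > 0" "\<And>s s'. s \<in> {0<..<l} \<Longrightarrow> s' \<in> {0<..<l} \<Longrightarrow>
      \<bar>s - t\<bar> < e \<Longrightarrow> \<bar>s' - t\<bar> < e \<Longrightarrow> flat_dist z f n (\<gamma> s) (\<gamma> s') = ennreal \<bar>s - s'\<bar>"
    using sc t unfolding saddle_connection_def by meson
  note int = saddle_connection_interior[OF sc]
  define x where "x = fst (\<gamma> t)"
  have "\<gamma> t \<in> flat_part z f n"
    using int(2) t by blast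
  then have x: "x \<in> - range z" and w: "snd (\<gamma> t) ^ n = f x"
    by (auto simp: flat_part_eq x_def surface_def)
  obtain r where r: "r > 0" "ball x r \<subseteq> - range z"
    using x closed_zeros open_contains_ball by (metis open_Compl)
  obtain g where g: "root_section (ball x r) g" "g x = snd (\<gamma> t)"
    using root_section_exists[of "ball x r" x "snd (\<gamma> t)"] r w by (auto simp: convex_imp_contractible)
  define G where "G = (\<lambda>y. (y, g y)) ` ball x r"
  \<comment> \<open>The graph \<open>G\<close> is open in the flat part, so the times spent in it
    form an open set containing \<open>t\<close>.\<close>
  have "openin (top_of_set {0<..<l}) ({0<..<l} \<inter> \<gamma> -` G)"
    using continuous_openin_preimage[OF int(1), of "flat_part z f n" G] int(2)
      openin_root_section_graph[OF g(1)] by (auto simp: G_def)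
  then have "open ({0<..<l} \<inter> \<gamma> -` G)"
    by (simp add: openin_open_eq)
  moreover have "t \<in> {0<..<l} \<inter> \<gamma> -` G"
    using t g r by (auto simp: G_def x_def intro!: image_eqI[of _ _ "fst (\<gamma> t)"] prod_eqI)
  ultimately obtain e' where e': "e' > 0" "ball t e' \<subseteq> {0<..<l} \<inter> \<gamma> -` G"
    by (meson open_contains_ball)
  show ?thesis
  proof
    show "min e e' > 0"
      using e e' by simp
    fix s s'
    assume s: "s \<in> ball t (min e e') \<inter> {0<..<l}" and s': "s' \<in> ball t (min e e') \<inter> {0<..<l}"
    have "\<gamma> s \<in> G" "\<gamma> s' \<in> G"
      using e'(2) s s' by auto
    then obtain y y' where y: "y \<in> ball x r" "\<gamma> s = (y, g y)" "y' \<in> ball x r" "\<gamma> s' = (y', g y')"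
      by (auto simp: G_def)
    have "flat_dist z f n (\<gamma> s) (\<gamma> s') = ennreal (dist y y')"
      unfolding y(2,4)
      by (intro flat_dist_root_section[OF g(1)] closed_segment_subset y convex_ball)
    moreover have "flat_dist z f n (\<gamma> s) (\<gamma> s') = ennreal \<bar>s - s'\<bar>"
      using s s' by (intro e) (auto simp: dist_real_def)
    ultimately show "dist (fst (\<gamma> s)) (fst (\<gamma> s')) = \<bar>s - s'\<bar>"
      by (simp add: y)
  qed
qed

lemma saddle_connection_affine:
  assumes sc: "saddle_connection z f n l \<gamma>"
  obtains a u where "norm u = 1" "\<And>s. s \<in> {0..l} \<Longrightarrow> fst (\<gamma> s) = a + s *\<^sub>R u"
proof -
  let ?c = "\<lambda>s. fst (\<gamma> s)"
  have l: "l > 0" and cl: "continuous_on {0..l} \<gamma>"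
    using sc by (auto simp: saddle_connection_def)
  have "\<exists>e>0. \<exists>u. \<forall>s\<in>ball t e \<inter> {0<..<l}. ?c s = ?c t + (s - t) *\<^sub>R u" if t: "t \<in> {0<..<l}" for t
  proof -
    obtain e where e: "e > 0" "\<And>s s'. s \<in> ball t e \<inter> {0<..<l} \<Longrightarrow> s' \<in> ball t e \<inter> {0<..<l} \<Longrightarrow>
       dist (?c s) (?c s') = \<bar>s - s'\<bar>"
      using saddle_connection_locally_isometric[OF sc t] by blast
    \<comment> \<open>A second time close to \<open>t\<close> is needed to fix the direction in
      \<open>isometric_imp_affine\<close>.\<close>
    obtain b where b: "t < b" "b < min (t + e) l"
      using dense[of t "min (t + e) l"] e(1) t by auto
    obtain u where "\<And>s. s \<in> ball t e \<inter> {0<..<l} \<Longrightarrow> ?c s = ?c t + (s - t) *\<^sub>R u"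
      by (rule isometric_imp_affine[where S = "ball t e \<inter> {0<..<l}" and c = ?c and a = t and b = b])
        (use e t b in \<open>auto simp: dist_real_def\<close>)
    then show ?thesis
      using e(1) by blast
  qed
  then obtain a u where au: "\<And>s. s \<in> {0<..<l} \<Longrightarrow> ?c s = a + s *\<^sub>R u"
    by (rule locally_affine_imp_affine[of "{0<..<l}" ?c, rotated 2]) auto
  \<comment> \<open>The affine formula passes from the open to the closed interval by
    continuity.\<close>
  have "?c s - s *\<^sub>R u = a" if "s \<in> {0..l}" for s
  proof (rule continuous_constant_on_closure[of "{0<..<l}" "\<lambda>s. ?c s - s *\<^sub>R u"])
    show "continuous_on (closure {0<..<l}) (\<lambda>s. ?c s - s *\<^sub>R u)"
      using l cl by (auto intro!: continuous_intros)
  qed (use au l that in auto)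
  then have aff: "?c s = a + s *\<^sub>R u" if "s \<in> {0..l}" for s
    using that by (metis add.commute diff_add_cancel)
  \<comment> \<open>The unit norm is not part of the glued affine formula; it is recovered from the
    local isometry at the midpoint \<open>l/2\<close>.\<close>
  obtain e where e: "e > 0" "\<And>s s'. s \<in> ball (l/2) e \<inter> {0<..<l} \<Longrightarrow>
      s' \<in> ball (l/2) e \<inter> {0<..<l} \<Longrightarrow> dist (?c s) (?c s') = \<bar>s - s'\<bar>"
    using saddle_connection_locally_isometric[OF sc, of "l/2"] l by auto
  obtain b where b: "l/2 < b" "b < min (l/2 + e) l"
    using dense[of "l/2" "min (l/2 + e) l"] e(1) l by auto
  have "norm ((b - l/2) *\<^sub>R u) = dist (?c b) (?c (l/2))"
    using b l by (simp add: aff dist_norm algebra_simps)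
  also have "\<dots> = \<bar>b - l/2\<bar>"
    using b l e(1) by (intro e(2)) (auto simp: dist_real_def)
  finally have "norm u = 1"
    using b by simp
  then show ?thesis
    using that aff by blast
qed

section \<open>From charts to holonomy vectors\<close>

text \<open>A chart differs from \<open>fst\<close> by a constant that may vary between components
  of \<open>U\<close>; connectedness of \<open>I\<close> makes it a single constant along the
  curve.\<close>

lemma translation_chart_along_curve:
  assumes ch: "translation_chart z f n U \<phi>" and \<gamma>: "continuous_on I \<gamma>" "\<gamma> ` I \<subseteq> U"
    and I: "connected I"
  obtains k where "\<And>s. s \<in> I \<Longrightarrow> \<phi> (\<gamma> s) = fst (\<gamma> s) + k"
proof -
  have "(\<lambda>s. \<phi> (\<gamma> s) - fst (\<gamma> s)) constant_on I"
  proof (rule locally_constant_imp_constant[OF I])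
    fix t assume t: "t \<in> I"
    then obtain V k where V: "openin (top_of_set U) V" "\<gamma> t \<in> V" "\<forall>q\<in>V. \<phi> q = fst q + k"
      using ch \<gamma>(2) unfolding translation_chart_def by blast
    have "openin (top_of_set I) (I \<inter> \<gamma> -` V)"
      using continuous_openin_preimage[OF \<gamma>(1) _ V(1)] \<gamma>(2) by auto
    then show "\<exists>T. openin (top_of_set I) T \<and> t \<in> T \<and>
        (\<forall>x\<in>T. \<phi> (\<gamma> x) - fst (\<gamma> x) = \<phi> (\<gamma> t) - fst (\<gamma> t))"
      using t V by (intro exI[of _ "I \<inter> \<gamma> -` V"]) auto
  qed
  then obtain k where "\<And>s. s \<in> I \<Longrightarrow> \<phi> (\<gamma> s) - fst (\<gamma> s) = k"
    by (auto simp: constant_on_def)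
  then show ?thesis
    by (intro that[of k]) (simp add: algebra_simps)
qed

text \<open>The projection joins two zeros with displacement \<open>l *\<^sub>R u\<close>. A
  holonomy vector is parallel to \<open>u\<close> and has norm \<open>l\<close>, which leaves only
  this displacement and its negative.\<close>

lemma Hol_imp_plane_saddle_connection:
  assumes "v \<in> Hol z f n"
  shows "\<exists>r l L. plane_saddle_connection z r l L \<and> (v = z r - z l \<or> v = z l - z r)"
proof -
  obtain l \<gamma> where sc: "saddle_connection z f n l \<gamma>" and hv: "holonomy_vector_of z f n l \<gamma> v"
    using assms by (auto simp: Hol_def)
  obtain a u where u: "norm u = 1" and aff: "\<And>s. s \<in> {0..l} \<Longrightarrow> fst (\<gamma> s) = a + s *\<^sub>R u"
    using saddle_connection_affine[OF sc] by blast
  have l: "l > 0" and "\<gamma> 0 \<in> cone_points z" "\<gamma> l \<in> cone_points z"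
    using sc by (auto simp: saddle_connection_def)
  then obtain i j where ij: "\<gamma> 0 = (z i, 0)" "\<gamma> l = (z j, 0)"
    by (auto simp: cone_points_def)
  have zi: "z i = a" and zj: "z j = a + l *\<^sub>R u"
    using aff[of 0] aff[of l] l ij by auto
  note int = saddle_connection_interior[OF sc]
  have "plane_saddle_connection z i j (closed_segment (z i) (z j))"
    unfolding plane_saddle_connection_def
  proof (intro conjI refl)
    \<comment> \<open>The cone points could coincide a priori, but the displacement has length
      \<open>l > 0\<close>.\<close>
    show "z i \<noteq> z j"
      using l u by (auto simp: zi zj)
    show "closed_segment (z i) (z j) - {z i, z j} \<subseteq> punctured_plane z"
    proof
      fix x assume x: "x \<in> closed_segment (z i) (z j) - {z i, z j}"
      then obtain t where t: "t \<in> {0<..<1}" "x = (1 - t) *\<^sub>R z i + t *\<^sub>R z j"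
        using \<open>z i \<noteq> z j\<close> by (auto simp: open_segment_image_interval simp flip: open_segment_def)
      have tl: "t * l \<in> {0<..<l}"
        using t(1) l by auto
      then have tl': "t * l \<in> {0..l}"
        unfolding greaterThanLessThan_iff atLeastAtMost_iff by linarith
      have x': "x = fst (\<gamma> (t * l))"
        by (simp add: t(2) zi zj aff[OF tl'] scaleR_diff_left scaleR_add_right)
      have "\<gamma> (t * l) \<in> flat_part z f n"
        using int(2) tl by blast
      then show "x \<in> punctured_plane z"
        unfolding x' flat_part_eq punctured_plane_def by simp
    qed
  qed
  moreover have "v = z i - z j \<or> v = z j - z i"
  proof -
    obtain U \<phi> p q c where ch: "translation_chart z f n U \<phi>" and U: "\<gamma> ` {0<..<l} \<subseteq> U"
      and seg: "\<phi> ` \<gamma> ` {0<..<l} = open_segment p q" and v: "v = c *\<^sub>R (q - p)"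
      and len: "ennreal (norm v) = curve_length 0 l (fst \<circ> \<gamma>)"
      using hv unfolding holonomy_vector_of_def by blast
    have "curve_length 0 l (fst \<circ> \<gamma>) = ennreal ((l - 0) * norm u)"
      using l aff by (intro curve_length_affine[where a = a]) auto
    then have nv: "norm v = l"
      using l len u by simp
    obtain k where k: "\<And>s. s \<in> {0<..<l} \<Longrightarrow> \<phi> (\<gamma> s) = fst (\<gamma> s) + k"
      using translation_chart_along_curve[OF ch int(1) U] by auto
    have pq: "p \<noteq> q"
      using seg l by (metis dense empty_iff greaterThanLessThan_iff image_is_empty open_segment_idem)
    have on_line: "\<exists>s. (1 - t) *\<^sub>R p + t *\<^sub>R q = a + k + s *\<^sub>R u" if "t \<in> {0<..<1}" for t
    proof -
      have "(1 - t) *\<^sub>R p + t *\<^sub>R q \<in> \<phi> ` \<gamma> ` {0<..<l}"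
        unfolding seg open_segment_image_interval using pq that by auto
      then obtain s where "s \<in> {0<..<l}" "(1 - t) *\<^sub>R p + t *\<^sub>R q = \<phi> (\<gamma> s)"
        by blast
      then show ?thesis
        using k[of s] aff[of s] by (intro exI[of _ s]) auto
    qed
    \<comment> \<open>The ends \<open>p\<close> and \<open>q\<close> are not in the image of the
      open curve, so two inner points are compared instead; their difference is a third of
      \<open>q - p\<close>.\<close>
    obtain s s' where s: "(1 - 1/3) *\<^sub>R p + (1/3) *\<^sub>R q = a + k + s *\<^sub>R u"
      and s': "(1 - 2/3) *\<^sub>R p + (2/3) *\<^sub>R q = a + k + s' *\<^sub>R u"
      using on_line[of "1/3"] on_line[of "2/3"] by auto
    have "(1/3) *\<^sub>R (q - p) = ((1 - 2/3) *\<^sub>R p + (2/3) *\<^sub>R q) - ((1 - 1/3) *\<^sub>R p + (1/3) *\<^sub>R q)"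
      by (simp add: complex_eq_iff)
    also have "\<dots> = (s' - s) *\<^sub>R u"
      unfolding s s' by (simp add: algebra_simps)
    finally have "q - p = (3 * (s' - s)) *\<^sub>R u"
      by (simp add: complex_eq_iff)
    then have v': "v = (c * (3 * (s' - s))) *\<^sub>R u"
      by (simp add: v)
    then have "\<bar>c * (3 * (s' - s))\<bar> = l"
      using nv u by simp
    then have "v = l *\<^sub>R u \<or> v = - (l *\<^sub>R u)"
      unfolding v' using l by (auto simp: abs_if split: if_splits)
    then show ?thesis
      by (auto simp: zi zj)
  qed
  ultimately show ?thesis
    by blast
qed

section \<open>Lifting plane segments to the surface\<close>

text \<open>
  The set of points seen from the midpoint of the segment without crossing a zero is starlike,
  hence carries a branch of the root of \<open>f\<close>.
\<close>

lemma root_section_along_segment: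
  assumes seg: "open_segment a b \<inter> range z = {}" and ab: "a \<noteq> b"
  obtains V g where "root_section V g" "open_segment a b \<subseteq> V"
proof -
  define m where "m = midpoint a b"
  define V where "V = {x. closed_segment m x \<inter> range z = {}}"
  have m: "m \<in> open_segment a b"
    using ab by (simp add: m_def)
  have sub: "open_segment a b \<subseteq> V"
  proof
    fix x assume "x \<in> open_segment a b"
    then have "closed_segment m x \<subseteq> open_segment a b"
      using m by (intro closed_segment_subset) auto
    then show "x \<in> V"
      using seg by (auto simp: V_def)
  qed
  have "open V"
    unfolding open_dist
  proof
    fix x assume "x \<in> V"
    then obtain d where d: "d > 0" "\<And>p q. p \<in> closed_segment m x \<Longrightarrow> q \<in> range z \<Longrightarrow> d \<le> dist p q"
      using separate_compact_closed[of "closed_segment m x" "range z"] closed_zeros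
      by (auto simp: V_def)
    have "y \<in> V" if y: "dist y x < d" for y
      unfolding V_def
    proof (clarify, rule ccontr)
      assume "closed_segment m y \<inter> range z \<noteq> {}"
      then obtain q t where q: "q \<in> range z" and t: "0 \<le> t" "t \<le> 1" "q = (1 - t) *\<^sub>R m + t *\<^sub>R y"
        unfolding closed_segment_def by blast
      \<comment> \<open>The point with the same parameter on the segment to \<open>x\<close> lies
        within \<open>dist y x\<close> of \<open>q\<close>, contradicting the gap \<open>d\<close>
        between that segment and the zeros.\<close>
      define p where "p = (1 - t) *\<^sub>R m + t *\<^sub>R x"
      have "p \<in> closed_segment m x"
        using t by (auto simp: p_def closed_segment_def)
      moreover have "p - q = t *\<^sub>R (x - y)"
        by (simp add: p_def t(3) scaleR_diff_right)
      then have "dist p q = t * dist y x"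
        using t by (simp add: dist_norm norm_minus_commute)
      then have "dist p q < d"
        using t y mult_left_le_one_le[of "dist y x" t] by simp
      ultimately show False
        using d(2)[of p q] q by simp
    qed
    then show "\<exists>e>0. \<forall>y. dist y x < e \<longrightarrow> y \<in> V"
      using d(1) by blast
  qed
  moreover have "contractible V"
  proof (rule starlike_imp_contractible)
    have "closed_segment m x \<subseteq> V" if "x \<in> V" for x
    proof
      fix y assume "y \<in> closed_segment m x"
      then have "closed_segment m y \<subseteq> closed_segment m x"
        by (simp add: subset_closed_segment)
      then show "y \<in> V"
        using that by (auto simp: V_def)
    qed
    then show "starlike V"
      using m sub by (auto simp: starlike_def)
  qed
  moreover have "V \<inter> range z = {}"
    by (auto simp: V_def)
  moreover have "f m \<noteq> 0"
    using zeros m seg by blast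
  \<comment> \<open>Any root at \<open>m\<close> may start the section; this one comes from the
    principal logarithm.\<close>
  then have "exp (Ln (f m) / of_nat n) ^ n = f m"
    using n by (simp flip: exp_of_nat_mult)
  ultimately obtain g where "root_section V g"
    using m sub by (elim root_section_exists) auto
  then show ?thesis
    using sub that by blast
qed

text \<open>On the graph \<open>fst\<close> has the continuous inverse that sends \<open>x\<close>
  to \<open>(x, g x)\<close>, and its translation constant is 0.\<close>

lemma translation_chart_root_section:
  assumes g: "root_section V g"
  shows "translation_chart z f n ((\<lambda>x. (x, g x)) ` V) fst"
  unfolding translation_chart_def
proof (intro conjI ballI)
  let ?U = "(\<lambda>x. (x, g x)) ` V"
  have img: "fst ` ?U = V"
    by force
  show "openin (top_of_set (flat_part z f n)) ?U"
    by (rule openin_root_section_graph[OF g])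
  show "open (fst ` ?U)"
    using g by (simp add: img root_section_def)
  show "\<exists>\<psi>. homeomorphism ?U (fst ` ?U) fst \<psi>"
    using g unfolding img homeomorphism_def
    by (intro exI[of _ "\<lambda>x. (x, g x)"] conjI ballI img)
      (auto simp: root_section_def intro!: continuous_intros)
  show "\<exists>V' c. openin (top_of_set ?U) V' \<and> p \<in> V' \<and> (\<forall>q\<in>V'. fst q = fst q + c)" if "p \<in> ?U" for p
    using that by (intro exI[of _ ?U] exI[of _ 0]) auto
qed

text \<open>The unit-speed segment is lifted by a root \<open>g\<close> defined on a neighbourhood
  \<open>V\<close> of the whole open segment. The graph of \<open>g\<close> over \<open>V\<close> is
  then one chart domain containing the interior of the lift.\<close>

lemma plane_saddle_connection_imp_Hol:
  assumes psc: "plane_saddle_connection z i j L" and v: "v = z i - z j \<or> v = z j - z i"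
  shows "v \<in> Hol z f n"
proof -
  define l where "l = dist (z i) (z j)"
  define u where "u = (z j - z i) /\<^sub>R l"
  define c where "c s = z i + s *\<^sub>R u" for s
  have ij: "z i \<noteq> z j"
    using psc by (simp add: plane_saddle_connection_def)
  have l: "l > 0" and lu: "l *\<^sub>R u = z j - z i"
    using ij by (simp_all add: l_def u_def)
  have u: "norm u = 1"
    using ij by (simp add: u_def l_def dist_norm norm_minus_commute)
  have "open_segment (z i) (z j) \<inter> range z = {}"
    using psc by (auto simp: plane_saddle_connection_def punctured_plane_def open_segment_def)
  then obtain V g where g: "root_section V g" and V: "open_segment (z i) (z j) \<subseteq> V"
    using root_section_along_segment ij by blast
  have cseg: "c ` {0<..<l} = open_segment (z i) (z j)"
  proof -
    have "{0<..<l} = (\<lambda>t. t * l) ` {0<..<1}"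
    proof (intro equalityI subsetI)
      show "s \<in> (\<lambda>t. t * l) ` {0<..<1}" if "s \<in> {0<..<l}" for s
        using that l by (intro image_eqI[of _ _ "s / l"]) auto
    qed (use l in auto)
    moreover have "c (t * l) = (1 - t) *\<^sub>R z i + t *\<^sub>R z j" for t
      by (simp add: c_def lu scaleR_diff_left scaleR_diff_right flip: scaleR_scaleR)
    ultimately show ?thesis
      using ij by (simp add: open_segment_image_interval image_image)
  qed
  have cV: "c s \<in> V" if "s \<in> {0<..<l}" for s
    using V cseg that by blast
  have c0: "c 0 = z i" and cl: "c l = z j"
    using lu by (simp_all add: c_def)
  have dc: "dist (c s) (c s') = \<bar>s - s'\<bar>" for s s'
  proof -
    have "c s - c s' = (s - s') *\<^sub>R u"
      by (simp add: c_def scaleR_diff_left)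
    then show ?thesis
      using u by (simp add: dist_norm)
  qed
  have contc: "continuous_on A c" for A
    unfolding c_def by (intro continuous_intros)
  \<comment> \<open>At the ends \<open>f\<close> vanishes, so 0 is the only value that keeps the
    curve on the surface.\<close>
  define w where "w s = (if s \<in> {0<..<l} then g (c s) else 0)" for s
  define \<gamma> where "\<gamma> s = (c s, w s)" for s
  have fz: "f (z k) = 0" for k
    by (simp add: zeros)
  have root: "w s ^ n = f (c s)" if "s \<in> {0..l}" for s
  proof (cases "s \<in> {0<..<l}")
    case True
    then show ?thesis
      using g cV by (simp add: w_def root_section_def)
  next
    case False
    then have "s = 0 \<or> s = l"
      using that by auto
    then show ?thesis
      using n fz c0 cl by (auto simp: w_def)
  qed
  have contw: "continuous (at s within {0..l}) w" if s: "s \<in> {0..l}" for s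
  proof (cases "s \<in> {0<..<l}")
    case True
    have "continuous_on {0<..<l} (\<lambda>s. g (c s))"
      by (rule continuous_on_compose2[of V g, OF _ contc])
        (use g cV in \<open>auto simp: root_section_def\<close>)
    then have "continuous_on {0<..<l} w"
      by (rule continuous_on_eq) (simp add: w_def)
    then have "isCont w s"
      using True by (simp add: continuous_on_eq_continuous_at)
    then show ?thesis
      by (rule continuous_at_imp_continuous_at_within)
  next
    case False
    then have ends: "s = 0 \<or> s = l"
      using s by auto
    then have ws: "w s = 0" and fs: "f (c s) = 0"
      using c0 cl fz by (auto simp: w_def)
    \<comment> \<open>Every branch has the same modulus, the real n-th root of the modulus of
      \<open>f\<close>. It tends to 0 at the ends, which gives continuity there.\<close>
    have nw: "norm (w x) = root n (norm (f (c x)))" if "x \<in> {0..l}" for x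
      unfolding root[OF that, symmetric] norm_power using n
      by (intro real_root_power_cancel[symmetric]) auto
    have "continuous_on {0..l} (\<lambda>x. root n (norm (f (c x))))"
      by (intro continuous_on_real_root continuous_on_norm continuous_on_compose2[OF cont contc])
        simp
    then have "((\<lambda>x. root n (norm (f (c x)))) \<longlongrightarrow> root n (norm (f (c s)))) (at s within {0..l})"
      using s unfolding continuous_on_def by (rule bspec)
    then have "((\<lambda>x. root n (norm (f (c x)))) \<longlongrightarrow> 0) (at s within {0..l})"
      unfolding fs by simp
    then have "((\<lambda>x. norm (w x)) \<longlongrightarrow> 0) (at s within {0..l})"
      by (rule tendsto_cong[THEN iffD1, rotated])
        (simp add: eventually_at_filter nw)
    then show ?thesis
      by (simp add: continuous_within ws tendsto_norm_zero_iff)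
  qed
  have sc: "saddle_connection z f n l \<gamma>"
    unfolding saddle_connection_def
  proof (intro conjI l)
    show "continuous_on {0..l} \<gamma>"
      unfolding \<gamma>_def using contw
      by (intro continuous_on_Pair contc) (simp add: continuous_on_eq_continuous_within)
    show "\<gamma> ` {0..l} \<subseteq> surface f n"
      using root by (auto simp: surface_def \<gamma>_def)
    show "\<gamma> 0 \<in> cone_points z" "\<gamma> l \<in> cone_points z"
      by (auto simp: \<gamma>_def w_def c0 cl cone_points_def)
    show "\<gamma> ` {0<..<l} \<inter> cone_points z = {}"
    proof -
      have "c s \<notin> range z" if "s \<in> {0<..<l}" for s
        using cV[OF that] g unfolding root_section_def by blast
      then show ?thesis
        by (fastforce simp: \<gamma>_def cone_points_def)
    qed
    show "\<forall>t\<in>{0<..<l}. \<exists>e>0. \<forall>s\<in>{0<..<l}. \<forall>s'\<in>{0<..<l}. \<bar>s - t\<bar> < e \<longrightarrow> \<bar>s' - t\<bar> < e \<longrightarrow>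
        flat_dist z f n (\<gamma> s) (\<gamma> s') = ennreal \<bar>s - s'\<bar>"
    \<comment> \<open>Any positive radius would do: the open segment is convex and inside
      \<open>V\<close>, so the lift is distance preserving on its entire interior.\<close>
    proof (intro ballI exI[of _ 1] conjI impI)
      fix s s' assume s: "s \<in> {0<..<l}" "s' \<in> {0<..<l}"
      then have "c s \<in> open_segment (z i) (z j)" "c s' \<in> open_segment (z i) (z j)"
        using cseg by auto
      then have "closed_segment (c s) (c s') \<subseteq> V"
        using V closed_segment_subset[of "c s" "open_segment (z i) (z j)" "c s'"] by auto
      then show "flat_dist z f n (\<gamma> s) (\<gamma> s') = ennreal \<bar>s - s'\<bar>"
        using s flat_dist_root_section[OF g] by (simp add: \<gamma>_def w_def dc)
    qed simp
  qed
  have "holonomy_vector_of z f n l \<gamma> v"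
    unfolding holonomy_vector_of_def
  proof (intro exI conjI)
    show "translation_chart z f n ((\<lambda>x. (x, g x)) ` V) fst"
      by (rule translation_chart_root_section[OF g])
    show "\<gamma> ` {0<..<l} \<subseteq> (\<lambda>x. (x, g x)) ` V"
      using cV by (auto simp: \<gamma>_def w_def)
    show "fst ` \<gamma> ` {0<..<l} = open_segment (z i) (z j)"
      using cseg by (simp add: image_image \<gamma>_def)
    show "v = (if v = z j - z i then 1 else -1) *\<^sub>R (z j - z i)"
      using v by auto
    have "curve_length 0 l (fst \<circ> \<gamma>) = ennreal ((l - 0) * norm u)"
      using l by (intro curve_length_affine[where a = "z i"]) (auto simp: \<gamma>_def c_def)
    moreover have "norm v = l"
      using v by (auto simp: l_def dist_norm norm_minus_commute)
    ultimately show "ennreal (norm v) = curve_length 0 l (fst \<circ> \<gamma>)"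
      using u by simp
  qed
  then show ?thesis
    using sc unfolding Hol_def by blast
qed

end

theorem theorem1p12:
  fixes z :: "nat \<Rightarrow> complex" and f :: "complex \<Rightarrow> complex" and n :: nat
  assumes "inj z"
    and "filterlim (\<lambda>k. norm (z k)) at_top sequentially"
    and "weierstrass_map z f"
    and "n \<ge> 2"
  shows "(\<forall>v. v \<in> Hol z f n \<longleftrightarrow>
            (\<exists>r l L. plane_saddle_connection z r l L \<and> (v = z r - z l \<or> v = z l - z r)))
         \<and> countable (Hol z f n)"
proof -
  interpret cyclic_cover z f n
  proof
    show "n > 0"
      using assms(4) by simp
  qed (rule weierstrass_map_continuous[OF assms(3)] weierstrass_map_eq_0_iff[OF assms(3)])+
  have iff: "v \<in> Hol z f n \<longleftrightarrow>
      (\<exists>r l L. plane_saddle_connection z r l L \<and> (v = z r - z l \<or> v = z l - z r))" for v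
    by (rule iffI) (fact Hol_imp_plane_saddle_connection, elim exE conjE,
        fact plane_saddle_connection_imp_Hol)
  \<comment> \<open>Both signs are covered because the union runs over all ordered pairs of indices,
    and these are countably many.\<close>
  have "Hol z f n \<subseteq> (\<Union>r l. {z r - z l})"
  proof
    fix v assume "v \<in> Hol z f n"
    then obtain r l where "v = z r - z l \<or> v = z l - z r"
      using Hol_imp_plane_saddle_connection by metis
    then show "v \<in> (\<Union>r l. {z r - z l})"
      by auto
  qed
  then have "countable (Hol z f n)"
    by (rule countable_subset) (intro countable_UN countable_insert countable_empty countableI_type)
  with iff show ?thesis
    by blast
qed

end
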